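(* Let $m$ be a flow measure on a tree $T$ rooted at infinity with vertex set $V$. The following are equivalent. (i) The measure $m$ is locally doubling. (ii) There exists a constant $c>1$ such that $$m(x)\le c\,m(y)\qquad\forall x\in V,\ y\in s(x),$$ $$m(x)\ge\frac{c}{c-1}\,m(y)\qquad\forall x\in V\text{ with }q(x)\ge2,\ y\in s(x).$$
   Context: Tree with root at infinity: $T=(V,E)$ is an (undirected) tree with geodesic distance $d$, $o\in V$ is a fixed origin, and a half-infinite geodesic starting at $o$ is fixed, identified with a boundary point, the root. For $x\in V$ let $\Pi(x)$ be the vertex of this geodesic closest to $x$; the level of $x$ is $\ell(x)=d(o,\Pi(x))-d(\Pi(x),x)$. The predecessor of $x$ is the unique neighbour of $x$ with level $\ell(x)+1$; the set of sons of $x$ is $s(x)=\{y\sim x:\ \ell(y)=\ell(x)-1\}$, and $q(x)=|s(x)|$. Flow measure: a function $m:V\to(0,\infty)$ (strictly positive) with $m(x)=\sum_{y\in s(x)}m(y)$ for all $x\in V$; also regarded as the measure $m(A)=\sum_{x\in A}m(x)$. It is locally doubling if for every $r>0$ there is $C_r>1$ with $m(B_{2r}(x))\le C_r m(B_r(x))$ for all $x\in V$, where $B_r(x)=\{y\in V: d(x,y)\le r\}$, $r\in\mathbb N$. *)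

theory Defs
  imports "HOL-Analysis.Analysis"
begin

definition adj :: "'v set set \<Rightarrow> 'v \<Rightarrow> 'v \<Rightarrow> bool" where
  "adj E x y \<longleftrightarrow> {x, y} \<in> E"

definition simple_graph :: "'v set \<Rightarrow> 'v set set \<Rightarrow> bool" where
  "simple_graph V E \<longleftrightarrow> (\<forall>e\<in>E. \<exists>x\<in>V. \<exists>y\<in>V. x \<noteq> y \<and> e = {x, y})"

definition graph_cycle :: "'v set set \<Rightarrow> 'v list \<Rightarrow> bool" where
  "graph_cycle E xs \<longleftrightarrow>
     length xs \<ge> 3 \<and> distinct xs \<and> successively (adj E) xs \<and> adj E (last xs) (hd xs)"

text \<open>Trees are not assumed to be finite or locally finite.\<close>

definition tree :: "'v set \<Rightarrow> 'v set set \<Rightarrow> bool" where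
  "tree V E \<longleftrightarrow> simple_graph V E \<and> V \<noteq> {} \<and>
     (\<forall>x\<in>V. \<forall>y\<in>V. (adj E)\<^sup>*\<^sup>* x y) \<and> (\<nexists>xs. graph_cycle E xs)"

text \<open>The geodesic distance: \<open>(adj E ^^ n) x y\<close> says that there is a walk of length \<open>n\<close>
  from \<open>x\<close> to \<open>y\<close>.\<close>

definition gdist :: "'v set set \<Rightarrow> 'v \<Rightarrow> 'v \<Rightarrow> nat" where
  "gdist E x y = (LEAST n. (adj E ^^ n) x y)"

definition gball :: "'v set \<Rightarrow> 'v set set \<Rightarrow> 'v \<Rightarrow> nat \<Rightarrow> 'v set" where
  "gball V E x r = {y \<in> V. gdist E x y \<le> r}"

definition geodesic_ray :: "'v set \<Rightarrow> 'v set set \<Rightarrow> (nat \<Rightarrow> 'v) \<Rightarrow> bool" where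
  "geodesic_ray V E \<omega> \<longleftrightarrow>
     range \<omega> \<subseteq> V \<and> (\<forall>i j. int (gdist E (\<omega> i) (\<omega> j)) = \<bar>int i - int j\<bar>)"

text \<open>The root at infinity is the boundary point represented by the ray \<open>\<omega>\<close>,
  which starts at the origin \<open>v0\<close>.\<close>

definition tree_rooted_at_infinity ::
    "'v set \<Rightarrow> 'v set set \<Rightarrow> 'v \<Rightarrow> (nat \<Rightarrow> 'v) \<Rightarrow> bool" where
  "tree_rooted_at_infinity V E v0 \<omega> \<longleftrightarrow> tree V E \<and> geodesic_ray V E \<omega> \<and> \<omega> 0 = v0"

definition ray_proj :: "'v set set \<Rightarrow> (nat \<Rightarrow> 'v) \<Rightarrow> 'v \<Rightarrow> 'v" where
  "ray_proj E \<omega> x = (THE z. is_arg_min (gdist E x) (\<lambda>w. w \<in> range \<omega>) z)"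

definition level :: "'v set set \<Rightarrow> 'v \<Rightarrow> (nat \<Rightarrow> 'v) \<Rightarrow> 'v \<Rightarrow> int" where
  "level E v0 \<omega> x = int (gdist E v0 (ray_proj E \<omega> x)) - int (gdist E (ray_proj E \<omega> x) x)"

definition sons :: "'v set set \<Rightarrow> 'v \<Rightarrow> (nat \<Rightarrow> 'v) \<Rightarrow> 'v \<Rightarrow> 'v set" where
  "sons E v0 \<omega> x = {y. adj E x y \<and> level E v0 \<omega> y = level E v0 \<omega> x - 1}"

text \<open>Extended naturals, since \<^const>\<open>card\<close> would give 0 on a vertex with infinitely many sons.\<close>

definition num_sons :: "'v set set \<Rightarrow> 'v \<Rightarrow> (nat \<Rightarrow> 'v) \<Rightarrow> 'v \<Rightarrow> enat" where
  "num_sons E v0 \<omega> x =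
     (if finite (sons E v0 \<omega> x) then enat (card (sons E v0 \<omega> x)) else \<infinity>)"

text \<open>On a finite set of sons, \<^const>\<open>has_sum\<close> is the ordinary finite sum.\<close>

definition flow_measure ::
    "'v set \<Rightarrow> 'v set set \<Rightarrow> 'v \<Rightarrow> (nat \<Rightarrow> 'v) \<Rightarrow> ('v \<Rightarrow> real) \<Rightarrow> bool" where
  "flow_measure V E v0 \<omega> m \<longleftrightarrow>
     (\<forall>x\<in>V. m x > 0) \<and> (\<forall>x\<in>V. (m has_sum m x) (sons E v0 \<omega> x))"

definition vertex_measure :: "'v set \<Rightarrow> ('v \<Rightarrow> real) \<Rightarrow> 'v measure" where
  "vertex_measure V m = point_measure V (\<lambda>x. ennreal (m x))"

definition locally_doubling :: "'v set \<Rightarrow> 'v set set \<Rightarrow> ('v \<Rightarrow> real) \<Rightarrow> bool" where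
  "locally_doubling V E m \<longleftrightarrow>
     (\<forall>r>0. \<exists>C>1. \<forall>x\<in>V.
        emeasure (vertex_measure V m) (gball V E x (2 * r))
          \<le> ennreal C * emeasure (vertex_measure V m) (gball V E x r))"

end

(* In a tree, the distance to a fixed vertex changes by one along every edge, and every other
   vertex has exactly one neighbour closer to it.  Letting the vertex run along the ray, the same
   follows for the level, so the neighbours of x are its sons and one predecessor.

   If m is locally doubling, compare the balls of radius 1 and 2 around a son z of y: the larger
   one contains the predecessor x of y, and the smaller one has mass 2 m(z) + m(y) <= 3 m(y).
   With a second son y', m(x) >= m(y) + m(y') >= m(y) + m(x)/c.  Conversely, if m(x) <= c m(y)
   for sons y of x, the neighbours of any vertex x have total mass at most (1 + c) m(x); iterating,
   the endpoints of walks of length n from x have mass at most (1 + c)^n m(x). *)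

theory Submission
  imports Defs
begin

section \<open>Sums over unions, walks and distances\<close>

text \<open>For nonnegative terms, overlaps only shrink the left side. This is needed because
  different walks may share an endpoint.\<close>

lemma sum_UN_le:
  fixes f :: "'a \<Rightarrow> real"
  assumes "finite I" "\<And>i. i \<in> I \<Longrightarrow> finite (A i)" "\<And>x. x \<in> (\<Union>i\<in>I. A i) \<Longrightarrow> 0 \<le> f x"
  shows "sum f (\<Union>i\<in>I. A i) \<le> (\<Sum>i\<in>I. sum f (A i))"
  using assms
proof (induction I rule: finite_induct)
  case (insert i I)
  have "sum f (A i \<union> (\<Union>i\<in>I. A i)) \<le> sum f (A i) + sum f (\<Union>i\<in>I. A i)"
    using insert.hyps insert.prems
    by (subst sum_Un) (auto intro!: sum_nonneg)
  also have "\<dots> \<le> sum f (A i) + (\<Sum>i\<in>I. sum f (A i))"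
    using insert.IH insert.prems by (intro add_left_mono) auto
  finally show ?case
    using insert.hyps by simp
qed auto

lemma adj_sym: "adj E x y \<Longrightarrow> adj E y x"
  by (simp add: adj_def insert_commute)

lemma relpowp_adj_sym: "(adj E ^^ n) x y \<Longrightarrow> (adj E ^^ n) y x"
proof (induction n arbitrary: y)
  case (Suc n)
  then obtain z where "(adj E ^^ n) x z" "adj E z y"
    by auto
  with Suc.IH have "adj E y z" "(adj E ^^ n) z x"
    by (auto intro: adj_sym)
  then show ?case
    by (rule relpowp_Suc_I2)
qed auto

lemma gdist_commute: "gdist E x y = gdist E y x"
proof -
  have "(adj E ^^ n) x y \<longleftrightarrow> (adj E ^^ n) y x" for n
    by (blast intro: relpowp_adj_sym)
  then show ?thesis
    by (simp add: gdist_def)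
qed

lemma gdist_le: "(adj E ^^ n) x y \<Longrightarrow> gdist E x y \<le> n"
  by (simp add: gdist_def Least_le)

section \<open>Distances to a fixed vertex of a tree\<close>

locale tree_graph =
  fixes V :: "'v set" and E :: "'v set set"
  assumes tree: "tree V E"
begin

lemma adj_in_V:
  assumes "adj E x y"
  shows "x \<in> V" and "y \<in> V"
  using assms tree by (auto simp: tree_def simple_graph_def adj_def doubleton_eq_iff)

lemma adj_neq: "adj E x y \<Longrightarrow> x \<noteq> y"
  using tree by (auto simp: tree_def simple_graph_def adj_def doubleton_eq_iff)

lemma relpowp_gdist:
  assumes "x \<in> V" "y \<in> V"
  shows "(adj E ^^ gdist E x y) x y"
proof -
  have "(adj E)\<^sup>*\<^sup>* x y"
    using tree assms by (auto simp: tree_def)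
  then obtain n where "(adj E ^^ n) x y"
    by (auto dest: rtranclp_imp_relpowp)
  then show ?thesis
    unfolding gdist_def by (rule LeastI)
qed

lemma gdist_0: "x \<in> V \<Longrightarrow> y \<in> V \<Longrightarrow> gdist E x y = 0 \<Longrightarrow> x = y"
  using relpowp_gdist[of x y] by simp

lemma gdist_step:
  assumes "a \<in> V" "adj E x y"
  shows "gdist E a y \<le> Suc (gdist E a x)"
proof -
  have "(adj E ^^ gdist E a x) a x"
    using assms by (intro relpowp_gdist) (auto dest: adj_in_V)
  then have "(adj E ^^ Suc (gdist E a x)) a y"
    using assms(2) by auto
  then show ?thesis
    by (rule gdist_le)
qed

text \<open>The vertex \<open>u'\<close> is the last one before \<open>u\<close> on a shortest walk
  from \<open>a\<close>.\<close>

lemma closer_neighbour: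
  assumes "a \<in> V" "u \<in> V" "gdist E a u = Suc n"
  obtains u' where "adj E u' u" "gdist E a u' = n"
proof -
  have "(adj E ^^ Suc n) a u"
    using relpowp_gdist[OF assms(1,2)] assms(3) by simp
  then obtain u' where u': "(adj E ^^ n) a u'" "adj E u' u"
    by auto
  have "gdist E a u' = n"
    using gdist_le[OF u'(1)] gdist_step[OF assms(1) u'(2)] assms(3) by simp
  with u'(2) that show ?thesis
    by blast
qed

text \<open>Following geodesics from both ends of such a path towards \<open>a\<close> until they meet would
  close up a cycle.\<close>

lemma no_path_outside_ball:
  assumes "a \<in> V" "length xs \<ge> 2" "distinct xs" "successively (adj E) xs"
    and "\<forall>z\<in>set xs. z \<in> V \<and> n \<le> gdist E a z"
    and "gdist E a (hd xs) = n" "gdist E a (last xs) = n"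
  shows False
  using assms(2-)
proof (induction n arbitrary: xs)
  case 0
  have "xs \<noteq> []"
    using 0(1) by auto
  then have xs: "hd xs \<in> set xs" "last xs \<in> set xs"
    by simp_all
  \<comment> \<open>At distance 0 both ends are \<open>a\<close>, which a list of at least two
    distinct vertices forbids.\<close>
  have "hd xs = last xs"
    using 0 xs gdist_0[OF assms(1)] by metis
  moreover have "hd xs \<noteq> last xs"
    using 0(1,2) by (cases xs) auto
  ultimately show False
    by simp
next
  case (Suc n)
  have xs: "xs \<noteq> []"
    using Suc.prems(1) by auto
  then have ends: "hd xs \<in> V" "last xs \<in> V"
    using Suc.prems(4) by simp_all
  obtain u where u: "adj E u (hd xs)" "gdist E a u = n"
    using closer_neighbour[OF assms(1) ends(1) Suc.prems(5)] .
  obtain v where v: "adj E v (last xs)" "gdist E a v = n"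
    using closer_neighbour[OF assms(1) ends(2) Suc.prems(6)] .
  have notin: "u \<notin> set xs" "v \<notin> set xs"
    using Suc.prems(4) u v by fastforce+
  show False
  proof (cases "u = v")
    case True
    \<comment> \<open>Both ends descend to the same vertex; as \<open>xs\<close> has at least two
      vertices, the cycle has at least three.\<close>
    have "graph_cycle E (u # xs)"
      using Suc.prems xs u v notin True
      by (auto simp: graph_cycle_def successively_Cons intro: adj_sym)
    with tree show False
      by (auto simp: tree_def)
  next
    case False
    show False
    \<comment> \<open>The path prolonged by \<open>u\<close> and \<open>v\<close> is again of the
      excluded kind, with ends at distance \<open>n\<close>.\<close>
    proof (rule Suc.IH)
      show "successively (adj E) (u # xs @ [v])"
        using Suc.prems xs u v
        by (auto simp: successively_Cons successively_append_iff intro: adj_sym)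
      show "\<forall>z\<in>set (u # xs @ [v]). z \<in> V \<and> n \<le> gdist E a z"
        using Suc.prems(4) u v by (auto dest: adj_in_V)
    qed (use Suc.prems xs u v notin False in auto)
  qed
qed

text \<open>Equidistant neighbours would form a path \<open>[x, y]\<close> that never comes closer
  to \<open>a\<close> than its ends.\<close>

lemma gdist_adj_neq:
  assumes "a \<in> V" "adj E x y"
  shows "gdist E a x \<noteq> gdist E a y"
  using no_path_outside_ball[OF assms(1), of "[x, y]" "gdist E a x"] assms adj_in_V[OF assms(2)]
    adj_neq[OF assms(2)]
  by auto

lemma gdist_adj_cases:
  assumes "a \<in> V" "adj E x y"
  obtains "gdist E a y = Suc (gdist E a x)" | "gdist E a x = Suc (gdist E a y)"
  using gdist_adj_neq[OF assms] gdist_step[OF assms] gdist_step[OF assms(1) adj_sym[OF assms(2)]]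
  by linarith

text \<open>Otherwise \<open>[y, x, z]\<close> would have equidistant ends and come no closer to
  \<open>a\<close> in between.\<close>

lemma closer_neighbour_unique:
  assumes "a \<in> V" "adj E x y" "adj E x z"
    and "gdist E a x = Suc (gdist E a y)" "gdist E a x = Suc (gdist E a z)"
  shows "y = z"
proof (rule ccontr)
  assume "y \<noteq> z"
  then show False
    using no_path_outside_ball[OF assms(1), of "[y, x, z]" "gdist E a y"] assms
      adj_in_V[OF assms(2)] adj_in_V[OF assms(3)] adj_neq[OF assms(2)] adj_neq[OF assms(3)]
      adj_sym[OF assms(2)]
    by auto
qed

end

section \<open>Levels, predecessors and sons\<close>

locale rooted_tree = tree_graph V E for V :: "'v set" and E :: "'v set set" +
  fixes v0 :: 'v and \<omega> :: "nat \<Rightarrow> 'v"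
  assumes rooted: "tree_rooted_at_infinity V E v0 \<omega>"
begin

abbreviation lev :: "'v \<Rightarrow> int" where "lev \<equiv> level E v0 \<omega>"
abbreviation sns :: "'v \<Rightarrow> 'v set" where "sns \<equiv> sons E v0 \<omega>"

lemma ray_in_V: "\<omega> i \<in> V"
  and ray_gdist: "int (gdist E (\<omega> i) (\<omega> j)) = \<bar>int i - int j\<bar>"
  and ray_0: "\<omega> 0 = v0"
  using rooted by (auto simp: tree_rooted_at_infinity_def geodesic_ray_def)

lemma ray_adj: "adj E (\<omega> i) (\<omega> (Suc i))"
proof -
  have "gdist E (\<omega> i) (\<omega> (Suc i)) = 1"
    using ray_gdist[of i "Suc i"] by simp
  with relpowp_gdist[OF ray_in_V ray_in_V, of i "Suc i"] show ?thesis
    by auto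
qed

lemma ray_neq: "\<omega> i \<noteq> \<omega> (Suc (Suc i))"
  using ray_gdist[of i "Suc (Suc i)"] ray_gdist[of i i] by auto

text \<open>The level is the Busemann function of the ray, with opposite sign.\<close>

lemma level_eq_eventually:
  assumes "x \<in> V"
  shows "\<exists>N. \<forall>k\<ge>N. lev x = int k - int (gdist E (\<omega> k) x)"
proof -
  define f where "f k = gdist E x (\<omega> k)" for k
  have f_Suc: "f (Suc k) = Suc (f k) \<or> f k = Suc (f (Suc k))" for k
    unfolding f_def by (rule gdist_adj_cases[OF assms ray_adj[of k]]) auto
  \<comment> \<open>Once the distance to \<open>x\<close> grows along the ray, it keeps growing: the
    only neighbour of \<open>\<omega> (Suc k)\<close> closer to \<open>x\<close> is
    \<open>\<omega> k\<close>, and the ray does not turn back.\<close>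
  have up: "f (Suc (Suc k)) = Suc (f (Suc k))" if "f (Suc k) = Suc (f k)" for k
    using closer_neighbour_unique[OF assms adj_sym[OF ray_adj[of k]] ray_adj[of "Suc k"]]
      ray_neq[of k] f_Suc[of "Suc k"] that unfolding f_def by blast
  \<comment> \<open>Choosing the first minimum makes \<open>f\<close> strictly larger before
    \<open>N\<close>; growth after \<open>N\<close> then makes the minimum unique.\<close>
  define N where "N = (LEAST n. \<forall>k. f n \<le> f k)"
  have "\<exists>n. \<forall>k. f n \<le> f k"
    using ex_has_least_nat[of "\<lambda>_. True" 0 f] by auto
  then have N: "f N \<le> f k" for k
    unfolding N_def by (rule LeastI2_ex) auto
  have below: "f N < f k" if "k < N" for k
  proof -
    have "\<not> (\<forall>j. f k \<le> f j)"
      using that unfolding N_def by (rule not_less_Least)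
    with N show ?thesis
      by (meson le_less_trans not_le)
  qed
  have step: "f (Suc (N + j)) = Suc (f (N + j))" for j
  proof (induction j)
    case 0
    show ?case
      using f_Suc[of N] N[of "Suc N"] by auto
  next
    case (Suc j)
    with up show ?case
      by simp
  qed
  have above: "f (N + j) = f N + j" for j
    by (induction j) (use step in auto)
  have above': "f N < f k" if "k > N" for k
    using above[of "k - N"] that by simp
  \<comment> \<open>Uniqueness of the nearest ray vertex gives the definite description in
    \<open>ray_proj\<close> its value.\<close>
  have "is_arg_min (gdist E x) (\<lambda>w. w \<in> range \<omega>) z \<longleftrightarrow> z = \<omega> N" for z
  proof
    assume "is_arg_min (gdist E x) (\<lambda>w. w \<in> range \<omega>) z"
    then obtain k where k: "z = \<omega> k" "f k \<le> f N"
      by (force simp: is_arg_min_def f_def not_less)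
    then have "k = N"
      using below[of k] above'[of k] by (cases k N rule: linorder_cases) auto
    with k show "z = \<omega> N"
      by simp
  next
    assume "z = \<omega> N"
    then show "is_arg_min (gdist E x) (\<lambda>w. w \<in> range \<omega>) z"
      using N by (auto simp: is_arg_min_def f_def not_less)
  qed
  then have "ray_proj E \<omega> x = \<omega> N"
    by (simp add: ray_proj_def)
  moreover have "gdist E v0 (\<omega> N) = N"
    using ray_gdist[of 0 N] ray_0 by simp
  ultimately have lev: "lev x = int N - int (f N)"
    by (simp add: level_def f_def gdist_commute)
  have "lev x = int k - int (gdist E (\<omega> k) x)" if "k \<ge> N" for k
    using above[of "k - N"] that lev by (simp add: f_def gdist_commute)
  then show ?thesis
    by blast
qed

text \<open>Along the ray, \<open>int k - int (gdist E (\<omega> k) x)\<close> is nondecreasing,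
  since the distance grows by at most 1 per step, and its eventual value is
  \<open>lev x\<close>.\<close>

lemma level_ge:
  assumes "x \<in> V"
  shows "int k - int (gdist E (\<omega> k) x) \<le> lev x"
proof -
  obtain N where N: "\<And>k. k \<ge> N \<Longrightarrow> lev x = int k - int (gdist E (\<omega> k) x)"
    using level_eq_eventually[OF assms] by blast
  have "int k - int (gdist E (\<omega> k) x) \<le> int (k + j) - int (gdist E (\<omega> (k + j)) x)" for j
  proof (induction j)
    case (Suc j)
    show ?case
      using Suc gdist_step[OF assms ray_adj[of "k + j"]] by (simp add: gdist_commute)
  qed simp
  from this[of N] N[of "k + N"] show ?thesis
    by simp
qed

text \<open>One far \<open>\<omega> k\<close> computes all levels in \<open>X\<close>, so comparing
  levels becomes comparing distances to a single vertex.\<close>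

lemma level_eq_common:
  assumes "finite X" "X \<subseteq> V"
  obtains k where "\<And>x. x \<in> X \<Longrightarrow> lev x = int k - int (gdist E (\<omega> k) x)"
proof -
  have "\<forall>\<^sub>F k in sequentially. lev x = int k - int (gdist E (\<omega> k) x)" if "x \<in> V" for x
    using level_eq_eventually[OF that] by (simp add: eventually_sequentially)
  then have "\<forall>\<^sub>F k in sequentially. \<forall>x\<in>X. lev x = int k - int (gdist E (\<omega> k) x)"
    using assms by (intro eventually_ball_finite) auto
  then show ?thesis
    using that by (auto simp: eventually_sequentially)
qed

lemma level_adj:
  assumes "adj E x y"
  shows "lev y = lev x + 1 \<or> lev y = lev x - 1"
proof -
  obtain k where "\<And>z. z \<in> {x, y} \<Longrightarrow> lev z = int k - int (gdist E (\<omega> k) z)"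
    using level_eq_common[of "{x, y}"] adj_in_V[OF assms] by auto
  then have "lev x = int k - int (gdist E (\<omega> k) x)" "lev y = int k - int (gdist E (\<omega> k) y)"
    by auto
  then show ?thesis
    by - (rule gdist_adj_cases[OF ray_in_V assms, of k]; simp)
qed

text \<open>The predecessor is the next vertex on the way from \<open>x\<close> to a far ray vertex:
  \<open>level_ge\<close> shows that the level rises, \<open>level_adj\<close> that it rises by
  exactly 1.\<close>

lemma predecessor_exists:
  assumes "x \<in> V"
  obtains p where "adj E x p" "lev p = lev x + 1"
proof -
  obtain N where N: "\<And>k. k \<ge> N \<Longrightarrow> lev x = int k - int (gdist E (\<omega> k) x)"
    using level_eq_eventually[OF assms] by blast
  \<comment> \<open>The second argument of \<open>max\<close> forces \<open>k > lev x\<close>, so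
    \<open>\<omega> k\<close> is at positive distance from \<open>x\<close>.\<close>
  define k where "k = max N (Suc (nat (lev x)))"
  have k: "lev x = int k - int (gdist E (\<omega> k) x)" "lev x < int k"
    using N[of k] by (auto simp: k_def)
  then obtain n where n: "gdist E (\<omega> k) x = Suc n"
    by (cases "gdist E (\<omega> k) x") auto
  then obtain p where p: "adj E p x" "gdist E (\<omega> k) p = n"
    using closer_neighbour[OF ray_in_V assms] by blast
  have "lev p \<ge> lev x + 1"
    using level_ge[of p k] adj_in_V[OF p(1)] p k n by simp
  with level_adj[of x p] adj_sym[OF p(1)] that show ?thesis
    by force
qed

text \<open>For a suitable \<open>k\<close>, both candidates are the neighbour of \<open>x\<close>
  closer to \<open>\<omega> k\<close>.\<close>

lemma predecessor_unique:
  assumes "adj E x y" "adj E x z" "lev y = lev x + 1" "lev z = lev x + 1"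
  shows "y = z"
proof -
  obtain k where "\<And>w. w \<in> {x, y, z} \<Longrightarrow> lev w = int k - int (gdist E (\<omega> k) w)"
    using level_eq_common[of "{x, y, z}"] adj_in_V[OF assms(1)] adj_in_V[OF assms(2)] by auto
  then have "lev x = int k - int (gdist E (\<omega> k) x)" "lev y = int k - int (gdist E (\<omega> k) y)"
    "lev z = int k - int (gdist E (\<omega> k) z)"
    by auto
  with closer_neighbour_unique[OF ray_in_V assms(1,2), of k] assms(3,4) show ?thesis
    by linarith
qed

lemma neighbours_eq:
  assumes "x \<in> sns p"
  shows "{y. adj E x y} = insert p (sns x)"
proof -
  have p: "adj E x p" "lev p = lev x + 1"
    using assms by (auto simp: sons_def intro: adj_sym)
  show ?thesis
  proof (intro equalityI subsetI)
    fix y assume "y \<in> {y. adj E x y}"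
    then have y: "adj E x y"
      by simp
    from level_adj[OF this] show "y \<in> insert p (sns x)"
    proof
      assume "lev y = lev x + 1"
      with predecessor_unique[OF y p(1) _ p(2)] show ?thesis
        by simp
    qed (use y in \<open>simp add: sons_def\<close>)
  qed (use p in \<open>auto simp: sons_def\<close>)
qed

lemma son_of_exists:
  assumes "x \<in> V"
  obtains p where "p \<in> V" "x \<in> sns p"
proof -
  obtain p where "adj E x p" "lev p = lev x + 1"
    using predecessor_exists[OF assms] .
  then show ?thesis
    using that[of p] by (auto simp: sons_def intro: adj_sym adj_in_V)
qed

lemma sons_subset: "sns x \<subseteq> V"
  by (auto simp: sons_def dest: adj_in_V)

lemma gball_1_subset:
  assumes "x \<in> sns p"
  shows "gball V E x 1 \<subseteq> insert x (insert p (sns x))"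
proof
  fix y assume "y \<in> gball V E x 1"
  then have y: "y \<in> V" "gdist E x y = 0 \<or> gdist E x y = 1"
    by (auto simp: gball_def le_Suc_eq)
  have "x \<in> V"
    using assms sons_subset by blast
  with y relpowp_gdist[of x y] have "x = y \<or> adj E x y"
    by auto
  with neighbours_eq[OF assms] show "y \<in> insert x (insert p (sns x))"
    by auto
qed

end

section \<open>Measures of sets of vertices\<close>

text \<open>Nonnegative terms converge absolutely, which turns the unordered sum into a nonnegative
  integral. Infinite \<open>X\<close> is allowed, as sets of sons are measured before they are known
  to be finite.\<close>

lemma emeasure_vertex_measure_has_sum:
  assumes "(m has_sum s) X" "X \<subseteq> V" "\<And>x. x \<in> V \<Longrightarrow> 0 \<le> m x"
  shows "emeasure (vertex_measure V m) X = ennreal s"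
proof -
  have "(\<lambda>x. norm (m x)) summable_on X"
    using has_sum_imp_summable[OF assms(1)] assms(2,3) by (subst summable_on_cong[of X _ m]) auto
  then have summable: "Infinite_Set_Sum.abs_summable_on m X"
    by (simp only: abs_summable_equivalent)
  have "emeasure (vertex_measure V m) X = (\<integral>\<^sup>+x. ennreal (m x) * indicator X x \<partial>count_space V)"
    using assms(2) by (simp add: vertex_measure_def point_measure_def emeasure_density)
  also have "\<dots> = (\<integral>\<^sup>+x\<in>X. ennreal (m x) \<partial>count_space UNIV)"
    using assms(2) by (subst nn_integral_count_space_indicator)
      (auto intro!: nn_integral_cong simp: indicator_def)
  also have "\<dots> = (\<integral>\<^sup>+x. ennreal (m x) \<partial>count_space X)"
    by (subst nn_integral_count_space_indicator) auto
  also have "\<dots> = ennreal (infsetsum m X)"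
    using summable assms(2,3) by (intro nn_integral_conv_infsetsum) auto
  also have "infsetsum m X = s"
    using summable assms(1) by (simp add: infsetsum_infsum infsumI)
  finally show ?thesis .
qed

lemma emeasure_vertex_measure_finite:
  assumes "finite X" "X \<subseteq> V" "\<And>x. x \<in> V \<Longrightarrow> 0 \<le> m x"
  shows "emeasure (vertex_measure V m) X = ennreal (\<Sum>x\<in>X. m x)"
  using assms by (intro emeasure_vertex_measure_has_sum has_sum_finite) auto

lemma sets_vertex_measure [simp]: "sets (vertex_measure V m) = Pow V"
  by (simp add: vertex_measure_def sets_point_measure)

section \<open>Consequences of doubling for flow measures\<close>

locale flow_tree = rooted_tree V E v0 \<omega>
  for V :: "'v set" and E v0 \<omega> +
  fixes m :: "'v \<Rightarrow> real"
  assumes flow: "flow_measure V E v0 \<omega> m"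
begin

lemma m_pos: "x \<in> V \<Longrightarrow> 0 < m x"
  and m_has_sum: "x \<in> V \<Longrightarrow> (m has_sum m x) (sns x)"
  using flow by (auto simp: flow_measure_def)

lemma m_nonneg: "x \<in> V \<Longrightarrow> 0 \<le> m x"
  using m_pos by force

lemma sum_le_m:
  assumes "x \<in> V" "finite F" "F \<subseteq> sns x"
  shows "sum m F \<le> m x"
  using finite_sum_le_has_sum[OF m_has_sum[OF assms(1)] assms(2,3)] sons_subset m_nonneg
  by blast

text \<open>An empty sum would force \<open>m x = 0\<close>.\<close>

lemma sons_nonempty: "x \<in> V \<Longrightarrow> sns x \<noteq> {}"
  using m_has_sum[of x] m_pos[of x] by (auto dest: infsumI)

text \<open>The balls are centred one generation below \<open>y\<close> because the ball of radius 1
  around \<open>y\<close> already contains \<open>x\<close>, so its mass could not be bounded in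
  terms of \<open>m y\<close>.\<close>

lemma m_le_of_doubling:
  assumes C: "C > 1" and doubling: "\<And>x. x \<in> V \<Longrightarrow> 
      emeasure (vertex_measure V m) (gball V E x 2)
        \<le> ennreal C * emeasure (vertex_measure V m) (gball V E x 1)"
    and x: "x \<in> V" and y: "y \<in> sns x"
  shows "m x \<le> 3 * C * m y"
proof -
  let ?\<mu> = "emeasure (vertex_measure V m)"
  have yV: "y \<in> V"
    using y sons_subset by blast
  with sons_nonempty obtain z where z: "z \<in> sns y"
    by blast
  then have zV: "z \<in> V"
    using sons_subset by blast
  have zy: "m z \<le> m y"
    using sum_le_m[OF yV, of "{z}"] z by simp
  have "(adj E ^^ 2) z x"
    using y z by (auto simp: sons_def numeral_2_eq_2 intro: adj_sym)
  then have "gdist E z x \<le> 2"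
    by (rule gdist_le)
  then have "?\<mu> {x} \<le> ?\<mu> (gball V E z 2)"
    using x by (intro emeasure_mono) (auto simp: gball_def)
  also have "\<dots> \<le> ennreal C * ?\<mu> (gball V E z 1)"
    using zV by (rule doubling)
  also have "?\<mu> (gball V E z 1) \<le> ?\<mu> ({z, y} \<union> sns z)"
    using gball_1_subset[OF z] sons_subset zV yV by (intro emeasure_mono) auto
  also have "\<dots> \<le> ?\<mu> {z, y} + ?\<mu> (sns z)"
    using sons_subset zV yV by (intro emeasure_subadditive) auto
  also have "?\<mu> {z, y} = ennreal (m z + m y)"
  proof -
    have "z \<noteq> y"
      using z adj_neq by (auto simp: sons_def)
    then show ?thesis
      using zV yV by (subst emeasure_vertex_measure_finite) (auto intro: m_nonneg)
  qed
  \<comment> \<open>The flow condition evaluates the sons of \<open>z\<close> together, however many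
    there are.\<close>
  also have "?\<mu> (sns z) = ennreal (m z)"
    using m_has_sum[OF zV] sons_subset m_nonneg by (rule emeasure_vertex_measure_has_sum)
  also have "?\<mu> {x} = ennreal (m x)"
    using x by (subst emeasure_vertex_measure_finite) (auto intro: m_nonneg)
  finally have "ennreal (m x) \<le> ennreal (C * (m z + m y + m z))"
    using C m_nonneg[OF zV] m_nonneg[OF yV]
    by (simp add: ennreal_mult mult_left_mono flip: ennreal_plus)
  then have "m x \<le> C * (m z + m y + m z)"
    using C m_nonneg[OF zV] m_nonneg[OF yV] by (subst (asm) ennreal_le_iff) auto
  also have "\<dots> \<le> C * (3 * m y)"
    using C zy by (intro mult_left_mono) auto
  finally show ?thesis
    by (simp add: mult_ac)
qed

text \<open>A second son carries at least \<open>m x / c\<close>, which leaves at most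
  \<open>(1 - 1 / c) * m x\<close> for \<open>y\<close>.\<close>

lemma m_ge_of_two_sons:
  assumes c: "c > 1" and le: "\<And>y. y \<in> sns x \<Longrightarrow> m x \<le> c * m y"
    and x: "x \<in> V" and two: "num_sons E v0 \<omega> x \<ge> 2" and y: "y \<in> sns x"
  shows "m x \<ge> c / (c - 1) * m y"
proof -
  have "sns x \<noteq> {y}"
  proof
    assume "sns x = {y}"
    with two have "(2::enat) \<le> enat 1"
      by (simp add: num_sons_def)
    then show False
      by (simp add: numeral_eq_enat)
  qed
  with y obtain z where z: "z \<in> sns x" "z \<noteq> y"
    by blast
  then have "m y + m z \<le> m x"
    using sum_le_m[OF x, of "{y, z}"] y by auto
  then have "c * m y + c * m z \<le> c * m x"
    using c by (simp flip: distrib_left)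
  with le[OF z(1)] have "c * m y \<le> (c - 1) * m x"
    by (simp add: algebra_simps)
  with c show ?thesis
    by (simp add: field_simps)
qed

section \<open>From the ratio bound to doubling\<close>

text \<open>Each son has mass at least \<open>m x / c\<close> and finitely many sons have total mass
  at most \<open>m x\<close>, so there are at most \<open>c\<close> of them.\<close>

lemma finite_sons:
  assumes "c > 0" and le: "\<And>y. y \<in> sns x \<Longrightarrow> m x \<le> c * m y" and x: "x \<in> V"
  shows "finite (sns x)"
proof -
  have "finite (sns x) \<and> card (sns x) \<le> nat \<lfloor>c\<rfloor>"
  proof (rule finite_if_finite_subsets_card_bdd)
    fix F assume F: "F \<subseteq> sns x" "finite F"
    have "of_nat (card F) * (m x / c) \<le> sum m F"
      using F le assms(1) by (intro sum_bounded_below) (auto simp: field_simps)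
    also have "\<dots> \<le> m x"
      using sum_le_m[OF x F(2,1)] .
    finally have "real (card F) \<le> c"
      using assms(1) m_pos[OF x] by (simp add: field_simps)
    then show "card F \<le> nat \<lfloor>c\<rfloor>"
      by linarith
  qed
  then show ?thesis ..
qed

text \<open>The predecessor contributes at most \<open>c * m x\<close>, as \<open>x\<close> is one
  of its sons; the sons contribute at most \<open>m x\<close>.\<close>

lemma sum_neighbours_le:
  assumes c: "c > 0" and le: "\<And>x y. x \<in> V \<Longrightarrow> y \<in> sns x \<Longrightarrow> m x \<le> c * m y" and x: "x \<in> V"
  shows "finite {y. adj E x y}" and "sum m {y. adj E x y} \<le> (1 + c) * m x"
proof -
  obtain p where p: "p \<in> V" "x \<in> sns p"
    using son_of_exists[OF x] .
  have fin: "finite (sns x)"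
    using c le[OF x] x by (rule finite_sons)
  then show "finite {y. adj E x y}"
    by (simp add: neighbours_eq[OF p(2)])
  have "p \<notin> sns x"
    using p by (auto simp: sons_def)
  then have "sum m {y. adj E x y} = m p + sum m (sns x)"
    using fin by (simp add: neighbours_eq[OF p(2)])
  also have "\<dots> \<le> c * m x + m x"
    using le[OF p] sum_le_m[OF x fin] by (intro add_mono) auto
  finally show "sum m {y. adj E x y} \<le> (1 + c) * m x"
    by (simp add: algebra_simps)
qed

text \<open>Endpoints of walks, unlike spheres, satisfy a plain recursion in \<open>n\<close>.
  Finiteness is part of the induction because \<open>sum\<close> is 0 on infinite sets.\<close>

lemma sum_walks_le:
  assumes c: "c > 0" and le: "\<And>x y. x \<in> V \<Longrightarrow> y \<in> sns x \<Longrightarrow> m x \<le> c * m y" and x: "x \<in> V"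
  shows "finite {y. (adj E ^^ n) x y} \<and> {y. (adj E ^^ n) x y} \<subseteq> V \<and>
    sum m {y. (adj E ^^ n) x y} \<le> (1 + c) ^ n * m x"
proof (induction n)
  case 0
  show ?case
    using x by simp
next
  case (Suc n)
  let ?W = "{y. (adj E ^^ n) x y}"
  have W: "finite ?W" "?W \<subseteq> V" "sum m ?W \<le> (1 + c) ^ n * m x"
    using Suc by auto
  have eq: "{y. (adj E ^^ Suc n) x y} = (\<Union>w\<in>?W. {y. adj E w y})"
    by auto
  have fin: "finite (\<Union>w\<in>?W. {y. adj E w y})"
    using W(1,2) sum_neighbours_le(1)[OF c le] by blast
  have "sum m (\<Union>w\<in>?W. {y. adj E w y}) \<le> (\<Sum>w\<in>?W. sum m {y. adj E w y})"
    using W(1,2) sum_neighbours_le(1)[OF c le] 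
    by (intro sum_UN_le) (auto intro: m_nonneg dest: adj_in_V)
  also have "\<dots> \<le> (\<Sum>w\<in>?W. (1 + c) * m w)"
    using W(2) by (intro sum_mono sum_neighbours_le(2)[OF c le]) auto
  also have "\<dots> \<le> (1 + c) * ((1 + c) ^ n * m x)"
    using W(3) c by (simp flip: sum_distrib_left)
  finally show ?case
    unfolding eq using fin by (auto simp: mult_ac dest: adj_in_V)
qed

text \<open>A vertex at distance \<open>n\<close> ends a walk of length \<open>n\<close>, so the
  ball is covered by the endpoint sets with \<open>n \<le> r\<close>.\<close>

lemma emeasure_gball_le:
  assumes c: "c > 0" and le: "\<And>x y. x \<in> V \<Longrightarrow> y \<in> sns x \<Longrightarrow> m x \<le> c * m y" and x: "x \<in> V"
  shows "emeasure (vertex_measure V m) (gball V E x r) \<le> ennreal ((\<Sum>n\<le>r. (1 + c) ^ n) * m x)"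
proof -
  let ?\<mu> = "emeasure (vertex_measure V m)"
  let ?W = "\<lambda>n. {y. (adj E ^^ n) x y}"
  note W = sum_walks_le[OF c le x]
  have "gball V E x r \<subseteq> (\<Union>n\<le>r. ?W n)"
    using relpowp_gdist[OF x] by (auto simp: gball_def)
  then have "?\<mu> (gball V E x r) \<le> ?\<mu> (\<Union>n\<le>r. ?W n)"
    using W by (intro emeasure_mono) auto
  also have "\<dots> \<le> (\<Sum>n\<le>r. ?\<mu> (?W n))"
    using W by (intro emeasure_subadditive_finite) auto
  also have "\<dots> \<le> (\<Sum>n\<le>r. ennreal ((1 + c) ^ n * m x))"
    using W m_nonneg by (intro sum_mono) (simp add: emeasure_vertex_measure_finite ennreal_leI)
  also have "\<dots> = ennreal ((\<Sum>n\<le>r. (1 + c) ^ n) * m x)"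
    using c m_nonneg[OF x] by (simp add: sum_distrib_right)
  finally show ?thesis .
qed

text \<open>The smaller ball contains its centre, hence has mass at least \<open>m x\<close>; the
  larger one has mass at most a constant times \<open>m x\<close>.\<close>

lemma locally_doubling_if_m_le:
  assumes c: "c > 0" and le: "\<And>x y. x \<in> V \<Longrightarrow> y \<in> sns x \<Longrightarrow> m x \<le> c * m y"
  shows "locally_doubling V E m"
  unfolding locally_doubling_def
proof (intro allI impI)
  fix r :: nat assume "r > 0"
  let ?\<mu> = "emeasure (vertex_measure V m)"
  define C where "C = (\<Sum>n\<le>2 * r. (1 + c) ^ n)"
  \<comment> \<open>These two terms occur in \<open>C\<close> because \<open>r > 0\<close>.\<close>
  have "1 < (1 + c) ^ 0 + (1 + c) ^ 1"
    using c by simp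
  also have "\<dots> = (\<Sum>n\<in>{0, 1}. (1 + c) ^ n)"
    by simp
  also have "\<dots> \<le> C"
    unfolding C_def using c \<open>r > 0\<close> by (intro sum_mono2) auto
  finally have "C > 1" .
  moreover have "?\<mu> (gball V E x (2 * r)) \<le> ennreal C * ?\<mu> (gball V E x r)" if x: "x \<in> V" for x
  proof -
    have "gdist E x x \<le> 0"
      by (rule gdist_le) simp
    then have "?\<mu> {x} \<le> ?\<mu> (gball V E x r)"
      using x by (intro emeasure_mono) (auto simp: gball_def)
    also have "?\<mu> {x} = ennreal (m x)"
      using x by (subst emeasure_vertex_measure_finite) (auto intro: m_nonneg)
    finally have "ennreal C * ennreal (m x) \<le> ennreal C * ?\<mu> (gball V E x r)"
      by (rule mult_left_mono) simp
    moreover have "?\<mu> (gball V E x (2 * r)) \<le> ennreal C * ennreal (m x)"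
      using emeasure_gball_le[OF c le x, of "2 * r"] \<open>C > 1\<close> m_nonneg[OF x]
      by (simp add: C_def ennreal_mult)
    ultimately show ?thesis
      by (rule order_trans[rotated])
  qed
  ultimately show "\<exists>C>1. \<forall>x\<in>V. ?\<mu> (gball V E x (2 * r)) \<le> ennreal C * ?\<mu> (gball V E x r)"
    by blast
qed

end

theorem proposition2p2:
  fixes V :: "'v set" and E :: "'v set set" and v0 :: 'v and \<omega> :: "nat \<Rightarrow> 'v"
    and m :: "'v \<Rightarrow> real"
  assumes "tree_rooted_at_infinity V E v0 \<omega>"
    and "flow_measure V E v0 \<omega> m"
  shows "locally_doubling V E m \<longleftrightarrow>
    (\<exists>c::real. c > 1 \<and>
       (\<forall>x\<in>V. \<forall>y\<in>sons E v0 \<omega> x. m x \<le> c * m y) \<and>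
       (\<forall>x\<in>V. num_sons E v0 \<omega> x \<ge> 2 \<longrightarrow>
          (\<forall>y\<in>sons E v0 \<omega> x. m x \<ge> c / (c - 1) * m y)))"
proof -
  interpret flow_tree V E v0 \<omega> m
    using assms by unfold_locales (auto simp: tree_rooted_at_infinity_def)
  show ?thesis
  proof
    assume "locally_doubling V E m"
    then obtain C where C: "C > 1" "\<And>x. x \<in> V \<Longrightarrow>
        emeasure (vertex_measure V m) (gball V E x 2)
          \<le> ennreal C * emeasure (vertex_measure V m) (gball V E x 1)"
      \<comment> \<open>Doubling is applied at radius 1.\<close>
      unfolding locally_doubling_def by (elim allE[of _ 1]) auto
    have "3 * C > 1"
      using C(1) by simp
    moreover have "m x \<le> 3 * C * m y" if "x \<in> V" "y \<in> sns x" for x y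
      using C that by (rule m_le_of_doubling)
    ultimately show "\<exists>c>1. (\<forall>x\<in>V. \<forall>y\<in>sns x. m x \<le> c * m y) \<and>
       (\<forall>x\<in>V. num_sons E v0 \<omega> x \<ge> 2 \<longrightarrow> (\<forall>y\<in>sns x. m x \<ge> c / (c - 1) * m y))"
      \<comment> \<open>The constant \<open>3 * C\<close> from the first inequality also serves in
        the second.\<close>
      using m_ge_of_two_sons by (intro exI[of _ "3 * C"]) blast
  next
    assume "\<exists>c>1. (\<forall>x\<in>V. \<forall>y\<in>sns x. m x \<le> c * m y) \<and>
       (\<forall>x\<in>V. num_sons E v0 \<omega> x \<ge> 2 \<longrightarrow> (\<forall>y\<in>sns x. m x \<ge> c / (c - 1) * m y))"
    then obtain c where "c > 1" "\<forall>x\<in>V. \<forall>y\<in>sns x. m x \<le> c * m y"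
      by blast
    then show "locally_doubling V E m"
      by (intro locally_doubling_if_m_le[of c]) auto
  qed
qed

end
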